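(* Let $n\ge 1$ and $1\le d\le n$ be integers and let $F(x_1,\dots,x_n)=\sum_{I\in\mathcal I_d(n)} f_I x_I$ be an integer multilinear $(n,d)$-form which is coprime, i.e. $\gcd(f_I)_{I\in\mathcal I_d(n)}=1$. Suppose in addition that at least one of the following two conditions holds: (a) the nonzero coefficients $f_I$ of $F$ are pairwise coprime; (b) $n=d+1$ and $F$ has a pair of coprime coefficients (i.e. there exist $I\neq J$ in $\mathcal I_d(n)$ with $\gcd(f_I,f_J)=1$). Then $F$ represents all integers. Moreover, for each $b\in\mathbb Z$ there exists $\mathbf a\in\mathbb Z^n$ with $F(\mathbf a)=b$ and $$|\mathbf a|\le |b|\,(2|F|)^{d!\,\mathrm e},$$ where $\mathrm e=2.71828\ldots$ is Euler's number.
   Context: $[n]=\{1,\dots,n\}$ and $\mathcal I_d(n)=\{I\subseteq[n]: |I|=d\}$. For $I=\{i_1<\dots<i_d\}$, $x_I=x_{i_1}\cdots x_{i_d}$. An integer multilinear $(n,d)$-form is a polynomial $\sum_{I\in\mathcal I_d(n)} f_I x_I$ with all $f_I\in\mathbb Z$. $F$ represents $b\in\mathbb Z$ if $F(\mathbf a)=b$ for some $\mathbf a\in\mathbb Z^n$. For $\mathbf a=(a_1,\dots,a_n)$, $|\mathbf a|=\max_i|a_i|$, and $|F|=\max_{I\in\mathcal I_d(n)}|f_I|$. *)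

theory Defs
  imports Complex_Main
begin

definition index_sets :: "nat \<Rightarrow> nat \<Rightarrow> nat set set" where
  "index_sets d n = {I. I \<subseteq> {1..n} \<and> card I = d}"

text \<open>
  An integer multilinear (n,d)-form is encoded by its family of coefficients
  \<open>f :: nat set \<Rightarrow> int\<close>, of which only the values on \<open>index_sets d n\<close> matter; an integer
  vector of length n is encoded by a function \<open>a :: nat \<Rightarrow> int\<close>, of which only the values
  on \<open>{1..n}\<close> matter.
\<close>

definition form_eval :: "nat \<Rightarrow> nat \<Rightarrow> (nat set \<Rightarrow> int) \<Rightarrow> (nat \<Rightarrow> int) \<Rightarrow> int" where
  "form_eval n d f a = (\<Sum>I\<in>index_sets d n. f I * (\<Prod>i\<in>I. a i))"

definition represents :: "nat \<Rightarrow> nat \<Rightarrow> (nat set \<Rightarrow> int) \<Rightarrow> int \<Rightarrow> bool" where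
  "represents n d f b \<longleftrightarrow> (\<exists>a. form_eval n d f a = b)"

text \<open>The maxima below are over nonempty finite sets when \<open>1 \<le> n\<close>, respectively \<open>d \<le> n\<close>.\<close>

definition vec_height :: "nat \<Rightarrow> (nat \<Rightarrow> int) \<Rightarrow> int" where
  "vec_height n a = Max ((\<lambda>i. \<bar>a i\<bar>) ` {1..n})"

definition form_height :: "nat \<Rightarrow> nat \<Rightarrow> (nat set \<Rightarrow> int) \<Rightarrow> int" where
  "form_height n d f = Max ((\<lambda>I. \<bar>f I\<bar>) ` index_sets d n)"

definition coprime_form :: "nat \<Rightarrow> nat \<Rightarrow> (nat set \<Rightarrow> int) \<Rightarrow> bool" where
  "coprime_form n d f \<longleftrightarrow> Gcd (f ` index_sets d n) = 1"

end

theory Submission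
  imports Defs
begin

text \<open>
  Restrict the form to a set of variables \<open>V\<close> such that any two distinct monomials that survive
  cover \<open>V\<close>; equivalently, every variable in \<open>V\<close> is missing from at most one monomial. In case (b)
  this holds for \<open>V = {1..n}\<close>, in case (a) for \<open>V = I \<union> J\<close> where \<open>I \<noteq> J\<close> carry nonzero coefficients
  and \<open>card (I \<union> J)\<close> is minimal. Given coprime coefficients at \<open>I\<close> and \<open>J\<close> and a common variable \<open>x\<close>,
  write the form as \<open>x G + K\<close>. By induction on the degree \<open>G\<close> takes the value 1 at a bounded point,
  and then \<open>x = b - K\<close> gives the value \<open>b\<close>, where \<open>K\<close> has at most one monomial. If \<open>I\<close> and \<open>J\<close> are
  disjoint, they are the only monomials, and Bezout's identity suffices.
\<close>

section \<open>Bounded Bezout coefficients and the height exponent\<close>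

lemma bezout_bounded:
  fixes u v H :: int
  assumes "coprime u v" "\<bar>u\<bar> \<le> H" "\<bar>v\<bar> \<le> H" "1 \<le> H"
  shows "\<exists>x y. u * x + v * y = 1 \<and> \<bar>x\<bar> \<le> H \<and> \<bar>y\<bar> \<le> H"
proof (cases "u = 0 \<or> v = 0")
  case True
  \<comment> \<open>If one of two coprime integers is 0, the other is a unit, so \<open>u\<close>
    and \<open>v\<close> serve as their own coefficients.\<close>
  then have "u * u + v * v = 1"
    using assms(1) by (auto simp: abs_if split: if_splits)
  then show ?thesis using assms by blast
next
  case False
  obtain x0 y0 where xy0: "u * x0 + v * y0 = 1"
    using assms(1) bezout_int[of u v] by (auto simp: mult.commute)
  \<comment> \<open>Reducing \<open>x0\<close> modulo \<bar>v\<bar> bounds \<open>x\<close> at once;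
    solving the identity for \<open>y\<close> then forces \<bar>y\<bar> \<le> \<bar>u\<bar>.\<close>
  define x where "x = x0 mod \<bar>v\<bar>"
  have x: "0 \<le> x" "x < \<bar>v\<bar>" using False by (auto simp: x_def)
  have "x0 = v * (sgn v * (x0 div \<bar>v\<bar>)) + x"
    by (simp add: x_def flip: mult.assoc abs_sgn)
  then have "u * x + v * (y0 + u * (sgn v * (x0 div \<bar>v\<bar>))) = 1"
    using xy0 by algebra
  then obtain y where y: "u * x + v * y = 1" by blast
  have "\<bar>v\<bar> * \<bar>y\<bar> = \<bar>1 - u * x\<bar>"
    using y by (metis abs_mult add_diff_cancel_left')
  also have "\<dots> \<le> 1 + \<bar>u\<bar> * x"
    using x abs_triangle_ineq4[of 1 "u * x"] by (simp add: abs_mult)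
  also have "\<dots> \<le> 1 + \<bar>u\<bar> * (\<bar>v\<bar> - 1)"
    using x by (intro add_left_mono mult_left_mono) auto
  also have "\<dots> \<le> \<bar>v\<bar> * \<bar>u\<bar>"
  proof -
    have "1 \<le> \<bar>u\<bar>" using False by linarith
    then show ?thesis by (simp add: right_diff_distrib mult.commute[of "\<bar>v\<bar>"])
  qed
  finally have "\<bar>y\<bar> \<le> \<bar>u\<bar>" using False by simp
  then show ?thesis using x y assms by (intro exI[of _ x] exI[of _ y]) auto
qed

lemma abs_prod_idom: "\<bar>prod f A\<bar> = (\<Prod>x\<in>A. \<bar>f x :: 'a :: linordered_idom\<bar>)"
  by (induction A rule: infinite_finite_induct) (simp_all add: abs_mult)

text \<open>The recurrence tracks the substitution x = b - K. In degree d + 1, K is one monomial in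
  d + 1 earlier values, which multiplies the exponent by d + 1; its coefficient and the addition of
  b cost one more factor 2H.\<close>

primrec height_exponent :: "nat \<Rightarrow> nat" where
  "height_exponent 0 = 0"
| "height_exponent (Suc d) = Suc d * height_exponent d + 1"

text \<open>Dividing the recurrence by the factorial makes it telescope to a partial sum of the
  exponential series. The term for k = 0 is subtracted because the recurrence starts at 0.\<close>

lemma height_exponent_le: "real (height_exponent d) \<le> fact d * exp 1"
proof -
  have "real (height_exponent d) = fact d * ((\<Sum>k<Suc d. 1 / fact k) - 1)"
  proof (induction d)
    case (Suc d)
    have "real (height_exponent (Suc d)) = real (Suc d) * (fact d * ((\<Sum>k<Suc d. 1 / fact k) - 1)) + 1"
      unfolding Suc[symmetric] by (simp add: distrib_right)
    also have "\<dots> = fact (Suc d) * ((\<Sum>k<Suc d. 1 / fact k) - 1) + fact (Suc d) * (1 / fact (Suc d))"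
      by (simp only: fact_Suc mult.assoc of_nat_id) simp
    also have "\<dots> = fact (Suc d) * ((\<Sum>k<Suc (Suc d). 1 / fact k) - 1)"
      by (simp only: sum.lessThan_Suc[of _ "Suc d"] distrib_left[symmetric]) simp
    finally show ?case .
  qed simp
  also have "\<dots> \<le> fact d * exp 1"
  proof (rule mult_left_mono)
    have "(\<Sum>k<Suc d. inverse (fact k) * 1 ^ k) \<le> exp (1::real)"
      using exp_converges[of "1::real"]
      by (intro sum_le_suminf[THEN order_trans]) (auto simp: sums_iff)
    then show "(\<Sum>k<Suc d. 1 / fact k) - 1 \<le> exp (1::real)"
      by (simp add: inverse_eq_divide)
  qed simp
  finally show ?thesis .
qed

section \<open>The induction on the degree\<close>

lemma form_solution_of_covering_pairs:
  fixes f :: "'a set \<Rightarrow> int" and H b :: int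
  assumes "finite V" "\<And>K. K \<in> \<F> \<Longrightarrow> K \<subseteq> V \<and> card K = d \<and> \<bar>f K\<bar> \<le> H"
    and "\<And>K L. K \<in> \<F> \<Longrightarrow> L \<in> \<F> \<Longrightarrow> K \<noteq> L \<Longrightarrow> K \<union> L = V"
    and "I \<in> \<F>" "J \<in> \<F>" "I \<noteq> J" "coprime (f I) (f J)" "1 \<le> H" "b \<noteq> 0"
  shows "\<exists>a. (\<Sum>K\<in>\<F>. f K * (\<Prod>i\<in>K. a i)) = b \<and>
             (\<forall>i. \<bar>a i\<bar> \<le> \<bar>b\<bar> * (2 * H) ^ height_exponent d)"
  using assms
proof (induction d arbitrary: V \<F> f I J b)
  case 0
  \<comment> \<open>In degree 0 the empty monomial is the only one, contradicting
    \<open>I \<noteq> J\<close>.\<close>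
  then have "I = {}" "J = {}" by (metis card_0_eq finite_subset)+
  with 0 show ?case by simp
next
  case (Suc d)
  let ?M = "2 * H" and ?S = "\<lambda>\<F> f a. \<Sum>K\<in>\<F>. f K * (\<Prod>i\<in>K. a i)"
  have M: "1 \<le> ?M" using Suc.prems by simp
  have b: "1 \<le> \<bar>b\<bar>" using Suc.prems by simp
  have fin: "finite \<F>" using Suc.prems(1,2) by (meson Pow_iff finite_Pow_iff finite_subset subsetI)
  have finK: "finite K" if "K \<in> \<F>" for K
    using that Suc.prems(1,2) finite_subset by blast
  show ?case
  proof (cases "I \<inter> J = {}")
    case True
    have cIJ: "card (I \<union> J) = 2 * Suc d"
      using True Suc.prems(2)[OF Suc.prems(4)] Suc.prems(2)[OF Suc.prems(5)]
        finK[OF Suc.prems(4)] finK[OF Suc.prems(5)] by (simp add: card_Un_disjoint)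
    \<comment> \<open>A third \<open>K\<close> must contain \<open>V\<close> minus \<open>I\<close>
      and \<open>V\<close> minus \<open>J\<close>, that is, both \<open>J\<close> and
      \<open>I\<close>. It would then have twice the allowed degree.\<close>
    have "K = I \<or> K = J" if K: "K \<in> \<F>" for K
    proof (rule ccontr)
      assume "\<not> (K = I \<or> K = J)"
      then have "K \<union> I = V" "K \<union> J = V" "I \<union> J = V"
        using Suc.prems K by blast+
      then have "K = I \<union> J"
        using True Suc.prems(2)[OF K] by blast
      then show False using cIJ Suc.prems(2)[OF K] by simp
    qed
    then have F: "\<F> = {I, J}" using Suc.prems by blast
    obtain x y where xy: "f I * x + f J * y = 1" "\<bar>x\<bar> \<le> H" "\<bar>y\<bar> \<le> H"
      using bezout_bounded Suc.prems by meson
    obtain p q where p: "p \<in> I" and q: "q \<in> J"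
      using Suc.prems(2)[OF Suc.prems(4)] Suc.prems(2)[OF Suc.prems(5)] by fastforce
    have pq: "p \<notin> J" "q \<notin> I" "p \<noteq> q" using p q True by auto
    \<comment> \<open>The disjoint monomials can be set independently: one variable of each carries
      the scaled Bezout coefficient, the others are 1.\<close>
    define a where "a = (\<lambda>i. if i = p then b * x else if i = q then b * y else 1)"
    have "prod a I = b * x"
    proof -
      have "prod a (I - {p}) = 1"
        using pq by (intro prod.neutral) (auto simp: a_def)
      then show ?thesis 
        using prod.remove[of I p a] p finK Suc.prems by (simp add: a_def)
    qed
    moreover have "prod a J = b * y"
    proof -
      have "prod a (J - {q}) = 1"
        using pq by (intro prod.neutral) (auto simp: a_def)
      then show ?thesis 
        using prod.remove[of J q a] q pq finK Suc.prems by (simp add: a_def)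
    qed
    ultimately have "?S \<F> f a = b * (f I * x + f J * y)"
      using F Suc.prems by (simp add: algebra_simps)
    then have "?S \<F> f a = b" using xy by simp
    moreover have "\<bar>a i\<bar> \<le> \<bar>b\<bar> * ?M ^ height_exponent (Suc d)" for i
    proof -
      have "\<bar>a i\<bar> \<le> \<bar>b\<bar> * H"
        using xy b Suc.prems mult_mono[of 1 "\<bar>b\<bar>" 1 H]
        by (auto simp: a_def abs_mult intro: mult_left_mono)
      also have "\<dots> \<le> \<bar>b\<bar> * ?M ^ 1"
        using Suc.prems by (intro mult_left_mono) auto
      also have "\<dots> \<le> \<bar>b\<bar> * ?M ^ height_exponent (Suc d)"
        using M by (intro mult_left_mono power_increasing) auto
      finally show ?thesis .
    qed
    ultimately show ?thesis by blast
  next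
    case False
    then obtain x where x: "x \<in> I" "x \<in> J" by blast
    \<comment> \<open>\<open>\<G>\<close> with coefficients \<open>g\<close> is the cofactor of
      \<open>x\<close>, and \<open>\<K>\<close> collects the monomials free of \<open>x\<close>. The
      covering property passes to \<open>\<G>\<close> with \<open>V - {x}\<close> in place of
      \<open>V\<close>.\<close>
    define \<G> where "\<G> = (\<lambda>K. K - {x}) ` {K \<in> \<F>. x \<in> K}"
    define g where "g = (\<lambda>K. f (insert x K))"
    define \<K> where "\<K> = {K \<in> \<F>. x \<notin> K}"
    have inj: "inj_on (\<lambda>K. K - {x}) {K \<in> \<F>. x \<in> K}"
      by (auto simp: inj_on_def)
    have "\<exists>a. ?S \<G> g a = 1 \<and> (\<forall>i. \<bar>a i\<bar> \<le> \<bar>1\<bar> * ?M ^ height_exponent d)"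
    proof (rule Suc.IH)
      show "finite (V - {x})" using Suc.prems by simp
      show "K \<subseteq> V - {x} \<and> card K = d \<and> \<bar>g K\<bar> \<le> H" if "K \<in> \<G>" for K
        using that Suc.prems(2) by (auto simp: \<G>_def g_def insert_absorb)
      show "K \<union> L = V - {x}" if KL: "K \<in> \<G>" "L \<in> \<G>" "K \<noteq> L" for K L
      proof -
        obtain K' L' where "K' \<in> \<F>" "L' \<in> \<F>" "K = K' - {x}" "L = L' - {x}"
          using KL(1,2) unfolding \<G>_def by blast
        then show ?thesis using Suc.prems(3)[of K' L'] KL(3) by auto
      qed
      show "I - {x} \<in> \<G>" "J - {x} \<in> \<G>" using x Suc.prems by (auto simp: \<G>_def)
      show "I - {x} \<noteq> J - {x}" using x Suc.prems by blast
      show "coprime (g (I - {x})) (g (J - {x}))"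
        using x Suc.prems by (simp add: g_def insert_absorb)
    qed (use Suc.prems in auto)
    then obtain a where a: "?S \<G> g a = 1" "\<And>i. \<bar>a i\<bar> \<le> ?M ^ height_exponent d"
      by auto
    define c where "c = ?S \<K> f a"
    \<comment> \<open>The cofactor has value 1 at \<open>a\<close>, so the form is linear in
      \<open>x\<close> with slope 1 and constant term \<open>c\<close>.\<close>
    define a' where "a' = a(x := b - c)"
    have S\<K>: "?S \<K> f a' = c"
      unfolding c_def a'_def \<K>_def by (intro sum.cong refl arg_cong2[of _ _ _ _ "(*)"] prod.cong) auto
    have "?S {K \<in> \<F>. x \<in> K} f a' = (\<Sum>K\<in>{K \<in> \<F>. x \<in> K}. (b - c) * (g (K - {x}) * prod a (K - {x})))"
    proof (rule sum.cong)
      fix K assume K: "K \<in> {K \<in> \<F>. x \<in> K}"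
      then have "prod a' K = (b - c) * prod a' (K - {x})"
        using prod.remove[of K x a'] finK by (simp add: a'_def)
      also have "prod a' (K - {x}) = prod a (K - {x})"
        by (intro prod.cong) (auto simp: a'_def)
      finally show "f K * prod a' K = (b - c) * (g (K - {x}) * prod a (K - {x}))"
        using K by (simp add: g_def insert_absorb)
    qed simp
    also have "\<dots> = (b - c) * ?S \<G> g a"
      unfolding \<G>_def sum.reindex[OF inj] by (simp add: sum_distrib_left)
    finally have S\<G>: "?S {K \<in> \<F>. x \<in> K} f a' = b - c" using a by simp
    have "?S \<F> f a' = ?S {K \<in> \<F>. x \<in> K} f a' + ?S \<K> f a'"
      unfolding \<K>_def using fin
      by (subst sum.union_disjoint[symmetric]) (auto intro: sum.cong)
    then have eq: "?S \<F> f a' = b" using S\<G> S\<K> by simp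
    have c: "\<bar>c\<bar> \<le> H * ?M ^ (Suc d * height_exponent d)"
    proof (cases "\<K> = {}")
      case True
      then show ?thesis using Suc.prems by (simp add: c_def)
    next
      case False
      then obtain K where K: "K \<in> \<K>" by blast
      \<comment> \<open>Two distinct monomials free of \<open>x\<close> could not cover
        \<open>V\<close>, which contains \<open>x\<close>.\<close>
      have "L = K" if L: "L \<in> \<K>" for L
      proof (rule ccontr)
        assume "L \<noteq> K"
        then have "L \<union> K = V" using Suc.prems(3) K L by (simp add: \<K>_def)
        moreover have "x \<in> V" using x Suc.prems(2,4) by blast
        ultimately show False using K L by (auto simp: \<K>_def)
      qed
      then have "\<K> = {K}" using K by blast
      then have "\<bar>c\<bar> = \<bar>f K\<bar> * (\<Prod>i\<in>K. \<bar>a i\<bar>)"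
        by (simp add: c_def abs_mult abs_prod_idom)
      also have "\<dots> \<le> H * (\<Prod>i\<in>K. ?M ^ height_exponent d)"
        using a Suc.prems(2)[of K] K Suc.prems
        by (intro mult_mono prod_mono prod_nonneg) (auto simp: \<K>_def)
      also have "(\<Prod>i\<in>K. ?M ^ height_exponent d) = ?M ^ (Suc d * height_exponent d)"
      proof -
        have "card K = Suc d" using Suc.prems(2)[of K] K by (simp add: \<K>_def)
        then show ?thesis by (simp only: prod_constant power_mult[symmetric] mult.commute)
      qed
      finally show ?thesis .
    qed
    have "\<bar>a' i\<bar> \<le> \<bar>b\<bar> * ?M ^ height_exponent (Suc d)" for i
    proof (cases "i = x")
      case True
      let ?P = "?M ^ (Suc d * height_exponent d)"
      have P: "1 \<le> ?P" using M by (rule one_le_power)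
      have HP: "1 \<le> H * ?P" using mult_mono[OF Suc.prems(8) P] Suc.prems(8) by simp
      have "\<bar>a' i\<bar> \<le> \<bar>b\<bar> + H * ?P" using True c by (simp add: a'_def)
      \<comment> \<open>Both summands are at most \<bar>b\<bar> * (H * ?P) because \<bar>b\<bar> and
        H * ?P are at least 1. The doubling supplies the missing 2 of the extra factor
        \<open>?M\<close>.\<close>
      also have "\<dots> \<le> \<bar>b\<bar> * (H * ?P) + \<bar>b\<bar> * (H * ?P)"
        using HP mult_left_mono[OF HP, of "\<bar>b\<bar>"] mult_right_mono[OF b, of "H * ?P"] by linarith
      also have "\<dots> = \<bar>b\<bar> * ?M ^ height_exponent (Suc d)" by simp
      finally show ?thesis .
    next
      case False
      then have "\<bar>a' i\<bar> \<le> 1 * ?M ^ height_exponent d" using a by (simp add: a'_def)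
      also have "\<dots> \<le> \<bar>b\<bar> * ?M ^ height_exponent (Suc d)"
        using M b by (intro mult_mono power_increasing) auto
      finally show ?thesis .
    qed
    with eq show ?thesis by blast
  qed
qed

section \<open>Application to multilinear forms\<close>

lemma finite_index_sets [simp]: "finite (index_sets d n)"
  by (rule finite_subset[of _ "Pow {1..n}"]) (auto simp: index_sets_def)

lemma abs_coeff_le_form_height: "I \<in> index_sets d n \<Longrightarrow> \<bar>f I\<bar> \<le> form_height n d f"
  unfolding form_height_def by (rule Max_ge) auto

lemma coprime_form_nonzero:
  assumes "coprime_form n d f"
  shows "\<exists>I\<in>index_sets d n. f I \<noteq> 0"
proof (rule ccontr)
  assume "\<not> ?thesis"
  then have "f ` index_sets d n \<subseteq> {0}" by auto
  then have "Gcd (f ` index_sets d n) = 0" by simp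
  then show False using assms unfolding coprime_form_def by linarith
qed

lemma vec_height_le: "1 \<le> n \<Longrightarrow> (\<And>i. \<bar>a i\<bar> \<le> B) \<Longrightarrow> vec_height n a \<le> B"
  unfolding vec_height_def by (subst Max_le_iff) auto

text \<open>A monomial not contained in \<open>V\<close> has a vanishing factor, so zeros outside
  \<open>V\<close> restrict the form to \<open>\<F>\<close>.\<close>

lemma form_eval_zero_outside:
  assumes "\<F> \<subseteq> index_sets d n" "\<And>K. K \<in> \<F> \<Longrightarrow> K \<subseteq> V"
    and "\<And>K. K \<in> index_sets d n - \<F> \<Longrightarrow> f K = 0 \<or> \<not> K \<subseteq> V"
  shows "form_eval n d f (\<lambda>i. if i \<in> V then a i else 0) = (\<Sum>K\<in>\<F>. f K * (\<Prod>i\<in>K. a i))"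
proof -
  let ?a = "\<lambda>i. if i \<in> V then a i else 0"
  have "(\<Prod>i\<in>K. ?a i) = 0" if "K \<in> index_sets d n" "\<not> K \<subseteq> V" for K
  proof -
    have "finite K" using that by (auto simp: index_sets_def intro: finite_subset)
    then show ?thesis using that by (auto simp: subset_iff)
  qed
  then have "form_eval n d f ?a = (\<Sum>K\<in>\<F>. f K * (\<Prod>i\<in>K. ?a i))"
    unfolding form_eval_def using assms(1,3)
    by (intro sum.mono_neutral_right ballI) (use finite_index_sets in force)+
  also have "\<dots> = (\<Sum>K\<in>\<F>. f K * (\<Prod>i\<in>K. a i))"
    using assms(2) by (intro sum.cong refl arg_cong2[of _ _ _ _ "(*)"] prod.cong) auto
  finally show ?thesis .
qed

text \<open>This transfers the covering result to forms: padding the solution with zeros does not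
  increase its height.\<close>

lemma form_solution_on_subset:
  assumes "1 \<le> n" "b \<noteq> 0" "V \<subseteq> {1..n}" "\<F> \<subseteq> index_sets d n" "\<And>K. K \<in> \<F> \<Longrightarrow> K \<subseteq> V"
    and "\<And>K. K \<in> index_sets d n - \<F> \<Longrightarrow> f K = 0 \<or> \<not> K \<subseteq> V"
    and "\<And>K L. K \<in> \<F> \<Longrightarrow> L \<in> \<F> \<Longrightarrow> K \<noteq> L \<Longrightarrow> K \<union> L = V"
    and "I \<in> \<F>" "J \<in> \<F>" "I \<noteq> J" "coprime (f I) (f J)" "1 \<le> form_height n d f"
  shows "\<exists>a. form_eval n d f a = b \<and>
             vec_height n a \<le> \<bar>b\<bar> * (2 * form_height n d f) ^ height_exponent d"
proof -
  let ?B = "\<bar>b\<bar> * (2 * form_height n d f) ^ height_exponent d"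
  have "\<exists>a. (\<Sum>K\<in>\<F>. f K * (\<Prod>i\<in>K. a i)) = b \<and> (\<forall>i. \<bar>a i\<bar> \<le> ?B)"
  proof (rule form_solution_of_covering_pairs)
    show "finite V" using assms(3) by (rule finite_subset) simp
    show "K \<subseteq> V \<and> card K = d \<and> \<bar>f K\<bar> \<le> form_height n d f" if "K \<in> \<F>" for K
      using that assms(4,5) abs_coeff_le_form_height by (auto simp: index_sets_def)
  qed (use assms in auto)
  then obtain a where a: "(\<Sum>K\<in>\<F>. f K * (\<Prod>i\<in>K. a i)) = b" "\<And>i. \<bar>a i\<bar> \<le> ?B" by blast
  have "0 \<le> ?B" using a(2)[of 0] by linarith
  then have "vec_height n (\<lambda>i. if i \<in> V then a i else 0) \<le> ?B"
    using a(2) assms(1) by (intro vec_height_le) auto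
  moreover have "form_eval n d f (\<lambda>i. if i \<in> V then a i else 0) = b"
    using form_eval_zero_outside[of \<F> d n V f a] assms(4,5,6) a(1) by simp
  ultimately show ?thesis by blast
qed

lemma form_solution:
  fixes b :: int
  assumes "1 \<le> n" "1 \<le> d" "coprime_form n d f" "b \<noteq> 0"
    and "pairwise (\<lambda>I J. coprime (f I) (f J)) {I \<in> index_sets d n. f I \<noteq> 0} \<or>
         (n = d + 1 \<and>
          (\<exists>I\<in>index_sets d n. \<exists>J\<in>index_sets d n. I \<noteq> J \<and> coprime (f I) (f J)))"
    and H: "1 \<le> form_height n d f"
  shows "\<exists>a. form_eval n d f a = b \<and>
             vec_height n a \<le> \<bar>b\<bar> * (2 * form_height n d f) ^ height_exponent d"
proof -
  let ?N = "{I \<in> index_sets d n. f I \<noteq> 0}"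
  consider (b) I J where "n = d + 1" "I \<in> index_sets d n" "J \<in> index_sets d n" "I \<noteq> J" "coprime (f I) (f J)"
    | (a) "pairwise (\<lambda>I J. coprime (f I) (f J)) ?N" "\<exists>I\<in>?N. \<exists>J\<in>?N. I \<noteq> J"
    | (single) "\<forall>I\<in>?N. \<forall>J\<in>?N. I = J"
    using assms(5) by blast
  then show ?thesis
  proof cases
    case b
    \<comment> \<open>The union of two distinct d-sets has more than d elements, and only d + 1 are
      available.\<close>
    have "K \<union> L = {1..n}" if "K \<in> index_sets d n" "L \<in> index_sets d n" "K \<noteq> L" for K L
    proof -
      have KL: "K \<subseteq> {1..n}" "L \<subseteq> {1..n}" "card K = d" "card L = d" "finite K" "finite L"
        using that by (auto simp: index_sets_def intro: finite_subset)
      have "K \<subset> K \<union> L" using KL that(3) card_subset_eq[of K L] by blast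
      then have "d < card (K \<union> L)" using KL psubset_card_mono[of "K \<union> L" K] by simp
      then show ?thesis using KL b(1) card_mono[of "{1..n}" "K \<union> L"]
        by (intro card_subset_eq) auto
    qed
    then show ?thesis using b assms
      by (intro form_solution_on_subset[of n b "{1..n}" "index_sets d n" d f I J])
         (auto simp: index_sets_def)
  next
    case a
    define P where "P = (\<lambda>(I, J). I \<in> ?N \<and> J \<in> ?N \<and> I \<noteq> J)"
    obtain p where "P p" using a(2) unfolding P_def by blast
    then obtain q where q: "P q" "\<forall>y. P y \<longrightarrow> card (fst q \<union> snd q) \<le> card (fst y \<union> snd y)"
      using ex_has_least_nat[of P p "\<lambda>q. card (fst q \<union> snd q)"] by blast
    obtain I J where "q = (I, J)" by fastforce
    then have IJ: "P (I, J)" and min: "\<And>K L. P (K, L) \<Longrightarrow> card (I \<union> J) \<le> card (K \<union> L)"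
      using q by auto
    have V: "I \<union> J \<subseteq> {1..n}" using IJ by (auto simp: P_def index_sets_def)
    \<comment> \<open>Otherwise \<open>K\<close> and \<open>L\<close> would be a pair with a smaller
      union, against the minimal choice of \<open>I\<close> and \<open>J\<close>.\<close>
    have "K \<union> L = I \<union> J" if "K \<in> ?N" "L \<in> ?N" "K \<noteq> L" "K \<subseteq> I \<union> J" "L \<subseteq> I \<union> J" for K L
      using that min[of K L] V by (intro card_seteq) (auto simp: P_def intro: finite_subset)
    moreover have "coprime (f I) (f J)" using a(1) IJ by (auto simp: P_def pairwise_def)
    moreover have "I \<in> ?N" "J \<in> ?N" "I \<noteq> J" using IJ by (auto simp: P_def)
    ultimately show ?thesis using assms(1,4) V H
      by (intro form_solution_on_subset[of n b "I \<union> J" "{K \<in> ?N. K \<subseteq> I \<union> J}" d f I J]) blast+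
  next
    case single
    \<comment> \<open>With a single nonzero coefficient there is no pair to work with, but that
      coefficient divides the gcd and is therefore a unit.\<close>
    obtain I where I: "I \<in> ?N"
      using coprime_form_nonzero[OF assms(3)] by blast
    have "f I dvd f K" if "K \<in> index_sets d n" for K
      using single I that by (cases "f K = 0") auto
    then have "f I dvd Gcd (f ` index_sets d n)" by (auto intro: Gcd_greatest)
    then have u: "\<bar>f I\<bar> = 1" using assms(3) by (simp add: coprime_form_def)
    have finI: "finite I" using I by (auto simp: index_sets_def intro: finite_subset)
    have "I \<noteq> {}" using I assms(2) by (auto simp: index_sets_def)
    then obtain p where p: "p \<in> I" by blast
    \<comment> \<open>The unit \<open>f I\<close> is its own inverse, so the monomial must take the
      value \<open>f I * b\<close>.\<close>
    let ?a = "\<lambda>i. if i \<in> I then if i = p then f I * b else 1 else 0"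
    have "prod (\<lambda>i. if i = p then f I * b else 1) I = f I * b"
      using finI p by simp
    then have "form_eval n d f ?a = f I * (f I * b)"
      using form_eval_zero_outside[of "{I}" d n I f "\<lambda>i. if i = p then f I * b else 1"] I single
      by auto
    also have "\<dots> = b" using u by (auto simp: abs_if split: if_splits)
    finally have "form_eval n d f ?a = b" .
    moreover have "vec_height n ?a \<le> \<bar>b\<bar> * (2 * form_height n d f) ^ height_exponent d"
    proof (rule vec_height_le)
      fix i
      have "1 \<le> \<bar>b\<bar>" using assms(4) by simp
      then have "\<bar>?a i\<bar> \<le> \<bar>b\<bar> * 1" using u by (simp add: abs_mult)
      also have "\<dots> \<le> \<bar>b\<bar> * (2 * form_height n d f) ^ height_exponent d"
        using H by (intro mult_left_mono one_le_power) auto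
      finally show "\<bar>?a i\<bar> \<le> \<dots>" .
    qed (use assms in simp)
    ultimately show ?thesis by blast
  qed
qed

theorem theorem1:
  fixes n d :: nat and f :: "nat set \<Rightarrow> int"
  assumes "1 \<le> n" and "1 \<le> d" and "d \<le> n"
    and "coprime_form n d f"
    and "pairwise (\<lambda>I J. coprime (f I) (f J)) {I \<in> index_sets d n. f I \<noteq> 0} \<or>
         (n = d + 1 \<and>
          (\<exists>I\<in>index_sets d n. \<exists>J\<in>index_sets d n. I \<noteq> J \<and> coprime (f I) (f J)))"
  shows "(\<forall>b. represents n d f b) \<and>
         (\<forall>b. \<exists>a. form_eval n d f a = b \<and>
            real_of_int (vec_height n a)
              \<le> real_of_int \<bar>b\<bar> * (2 * real_of_int (form_height n d f)) powr (fact d * exp 1))"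
proof -
  obtain I where I: "I \<in> index_sets d n" "f I \<noteq> 0"
    using coprime_form_nonzero[OF assms(4)] by blast
  then have H: "1 \<le> form_height n d f"
    using abs_coeff_le_form_height[OF I(1), of f] by linarith
  have "\<exists>a. form_eval n d f a = b \<and>
          real_of_int (vec_height n a)
            \<le> real_of_int \<bar>b\<bar> * (2 * real_of_int (form_height n d f)) powr (fact d * exp 1)" for b
  proof (cases "b = 0")
    case True
    \<comment> \<open>For b = 0 the bound is 0 and forces the zero vector, which is a solution
      because the degree is positive.\<close>
    have "form_eval n d f (\<lambda>_. 0) = b"
      unfolding form_eval_def True
      by (rule sum.neutral) (use assms(2) in \<open>auto simp: index_sets_def\<close>)
    moreover have "vec_height n (\<lambda>_. 0) \<le> 0" using assms(1) by (intro vec_height_le) auto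
    ultimately show ?thesis using True by (intro exI[of _ "\<lambda>_. 0"]) simp
  next
    case False
    then obtain a where a: "form_eval n d f a = b"
      "vec_height n a \<le> \<bar>b\<bar> * (2 * form_height n d f) ^ height_exponent d"
      using form_solution assms H by blast
    let ?M = "2 * real_of_int (form_height n d f)"
    have "real_of_int (vec_height n a) \<le> real_of_int (\<bar>b\<bar> * (2 * form_height n d f) ^ height_exponent d)"
      using a(2) by (rule of_int_le_iff[THEN iffD2])
    also have "\<dots> = real_of_int \<bar>b\<bar> * ?M powr real (height_exponent d)"
      using H by (simp add: powr_realpow)
    \<comment> \<open>The base is at least 2, so raising the exponent only weakens the
      bound.\<close>
    also have "\<dots> \<le> real_of_int \<bar>b\<bar> * ?M powr (fact d * exp 1)"
      using H height_exponent_le[of d] by (intro mult_left_mono powr_mono) auto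
    finally show ?thesis using a(1) by blast
  qed
  then show ?thesis unfolding represents_def by blast
qed

end
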